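(* Let $n\in\mathbb{N}$, $k\in\{1,\dots,n\}$, and let $\mu$ be a $k$-homogeneous probability measure on $\Omega:=\{0,1\}^n$ with the stochastic covering property (SCP). Let $\widetilde\Omega=\{(x,y)\in\Omega^2:\ x\text{ and }y\text{ differ on exactly }2\text{ coordinates}\}$. Then there exists a Markov generator $Q$ on $\Omega$, reversible with respect to $\mu$, supported on $\widetilde\Omega$ (i.e. $Q(x,y)=0$ whenever $x\ne y$ and $(x,y)\notin\widetilde\Omega$) and satisfying $\max\{-Q(x,x):x\in\Omega\}\le 1$, such that for any $f:\Omega\to\mathcal{H}_d$, $$\mathrm{Var}_\mu(f)\preceq 2k\,\mathcal{E}(f),$$ where $\mathcal{E}$ is the matrix Dirichlet form associated with $Q$ (and $\mu$).
   Context: $\mathcal{H}_d$ is the set of $d\times d$ Hermitian matrices, $\preceq$ between matrices is the positive semi-definite order, and $\mathrm{Var}_\mu(f)=\mathbb{E}_\mu[f^2]-(\mathbb{E}_\mu f)^2$ (entrywise expectation). A Markov generator $Q$ on the finite set $\Omega$ is a real $|\Omega|\times|\Omega|$ matrix with $Q(x,y)\ge0$ for $x\neq y$ and $Q(x,x)=-\sum_{y\ne x}Q(x,y)$. It is reversible with respect to $\mu$ if $\mu(x)Q(x,y)=\mu(y)Q(y,x)$ for all $x,y$. The matrix Dirichlet form is $\mathcal{E}(f)=-\mathbb{E}_\mu[f\,(Qf)]$ with $(Qf)(x)=\sum_yQ(x,y)f(y)$; by reversibility $\mathcal{E}(f)=\frac12\sum_{x,y\in\Omega}\mu(x)Q(x,y)(f(y)-f(x))^2$.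 $\mu$ is $k$-homogeneous if $\mathbb{P}(\sum_{i=1}^n\xi_i=k)=1$ when $\xi\sim\mu$. For a finite index set $T$ and $x,y\in\{0,1\}^T$, write $x\preceq y$ if $x=y$ or $y$ is obtained from $x$ by changing exactly one coordinate from $0$ to $1$ (the other coordinates being equal). For probability measures $\mu_1,\mu_2$ on $\{0,1\}^T$, write $\mu_1\preceq\mu_2$ if there is a coupling $\kappa$ of $\mu_1$ and $\mu_2$ whose support is contained in $\{(x,y):x\preceq y\}$. Let $\xi\sim\mu$ and for $S\subseteq\{1,\dots,n\}$ let $\xi_S$ be the restriction of $\xi$ to the coordinates in $S$. $\mu$ has the stochastic covering property if for every $S\subseteq\{1,\dots,n\}$ and all $x_S,y_S\in\{0,1\}^S$ (with $\xi_S=x_S$ and $\xi_S=y_S$ both of positive probability), $$x_S\preceq y_S\ \Longrightarrow\ \mu(\cdot\mid\xi_S=y_S)\preceq\mu(\cdot\mid\xi_S=x_S),$$ where the conditional laws are regarded as probability measures on $\{0,1\}^{S^c}$. *)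

theory Defs
  imports "HOL-Probability.Probability" "Jordan_Normal_Form.Schur_Decomposition"
begin

section \<open>Measures on the hypercube\<close>

text \<open>Points of the cube over an index set are extensional functions, so that restricting a point
  to a smaller index set again gives a point of the smaller cube. Probability measures on a cube are
  pmfs whose support is contained in it.\<close>

definition hcube :: "nat set \<Rightarrow> (nat \<Rightarrow> nat) set" where
  "hcube T = T \<rightarrow>\<^sub>E {0, 1}"

definition homogeneous :: "nat \<Rightarrow> nat \<Rightarrow> (nat \<Rightarrow> nat) pmf \<Rightarrow> bool" where
  "homogeneous n k \<mu> \<longleftrightarrow> measure_pmf.prob \<mu> {\<xi>. (\<Sum>i\<in>{1..n}. \<xi> i) = k} = 1"

definition point_le :: "nat set \<Rightarrow> (nat \<Rightarrow> nat) \<Rightarrow> (nat \<Rightarrow> nat) \<Rightarrow> bool" where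
  "point_le T x y \<longleftrightarrow> x \<in> hcube T \<and> y \<in> hcube T \<and>
     (x = y \<or> (\<exists>i\<in>T. x i = 0 \<and> y i = 1 \<and> (\<forall>j\<in>T - {i}. x j = y j)))"

definition is_coupling :: "'a pmf \<Rightarrow> 'b pmf \<Rightarrow> ('a \<times> 'b) pmf \<Rightarrow> bool" where
  "is_coupling p q \<kappa> \<longleftrightarrow> map_pmf fst \<kappa> = p \<and> map_pmf snd \<kappa> = q"

definition measure_le :: "nat set \<Rightarrow> (nat \<Rightarrow> nat) pmf \<Rightarrow> (nat \<Rightarrow> nat) pmf \<Rightarrow> bool" where
  "measure_le T \<mu>1 \<mu>2 \<longleftrightarrow>
     (\<exists>\<kappa>. is_coupling \<mu>1 \<mu>2 \<kappa> \<and> set_pmf \<kappa> \<subseteq> {(x, y). point_le T x y})"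

definition restr_event :: "nat set \<Rightarrow> (nat \<Rightarrow> nat) \<Rightarrow> (nat \<Rightarrow> nat) set" where
  "restr_event S xS = {\<xi>. restrict \<xi> S = xS}"

text \<open>The conditional law given the coordinates in \<open>S\<close>, pushed forward to the cube over the
  complement of \<open>S\<close>. As for \<^const>\<open>cond_pmf\<close>, it is meaningful only if the conditioning event has
  positive probability.\<close>

definition cond_law :: "nat \<Rightarrow> (nat \<Rightarrow> nat) pmf \<Rightarrow> nat set \<Rightarrow> (nat \<Rightarrow> nat) \<Rightarrow> (nat \<Rightarrow> nat) pmf" where
  "cond_law n \<mu> S xS = map_pmf (\<lambda>\<xi>. restrict \<xi> ({1..n} - S)) (cond_pmf \<mu> (restr_event S xS))"

definition stochastic_covering :: "nat \<Rightarrow> (nat \<Rightarrow> nat) pmf \<Rightarrow> bool" where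
  "stochastic_covering n \<mu> \<longleftrightarrow>
     (\<forall>S xS yS. S \<subseteq> {1..n} \<longrightarrow> xS \<in> hcube S \<longrightarrow> yS \<in> hcube S \<longrightarrow>
        measure_pmf.prob \<mu> (restr_event S xS) > 0 \<longrightarrow>
        measure_pmf.prob \<mu> (restr_event S yS) > 0 \<longrightarrow>
        point_le S xS yS \<longrightarrow>
        measure_le ({1..n} - S) (cond_law n \<mu> S yS) (cond_law n \<mu> S xS))"

definition two_flip_pairs :: "nat \<Rightarrow> ((nat \<Rightarrow> nat) \<times> (nat \<Rightarrow> nat)) set" where
  "two_flip_pairs n =
     {(x, y). x \<in> hcube {1..n} \<and> y \<in> hcube {1..n} \<and> card {i\<in>{1..n}. x i \<noteq> y i} = 2}"

section \<open>Markov generators\<close>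

definition markov_generator :: "'a set \<Rightarrow> ('a \<Rightarrow> 'a \<Rightarrow> real) \<Rightarrow> bool" where
  "markov_generator \<Omega> Q \<longleftrightarrow>
     (\<forall>x\<in>\<Omega>. \<forall>y\<in>\<Omega>. x \<noteq> y \<longrightarrow> Q x y \<ge> 0) \<and> (\<forall>x\<in>\<Omega>. Q x x = - (\<Sum>y\<in>\<Omega> - {x}. Q x y))"

definition reversible :: "'a set \<Rightarrow> 'a pmf \<Rightarrow> ('a \<Rightarrow> 'a \<Rightarrow> real) \<Rightarrow> bool" where
  "reversible \<Omega> \<mu> Q \<longleftrightarrow> (\<forall>x\<in>\<Omega>. \<forall>y\<in>\<Omega>. pmf \<mu> x * Q x y = pmf \<mu> y * Q y x)"

section \<open>Hermitian matrices and matrix-valued functions\<close>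

definition hermitian_mats :: "nat \<Rightarrow> complex mat set" where
  "hermitian_mats d = {A \<in> carrier_mat d d. mat_adjoint A = A}"

text \<open>For Hermitian \<open>A\<close> the quadratic form is real, so taking the real part loses nothing.\<close>

definition pos_semidef :: "nat \<Rightarrow> complex mat \<Rightarrow> bool" where
  "pos_semidef d A \<longleftrightarrow>
     A \<in> hermitian_mats d \<and> (\<forall>v\<in>carrier_vec d. Re ((A *\<^sub>v v) \<bullet>c v) \<ge> 0)"

definition psd_le :: "nat \<Rightarrow> complex mat \<Rightarrow> complex mat \<Rightarrow> bool" where
  "psd_le d A B \<longleftrightarrow> A \<in> hermitian_mats d \<and> B \<in> hermitian_mats d \<and> pos_semidef d (B - A)"

text \<open>The type of matrices has no additive monoid instance (dimensions are not part of the type), so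
  linear combinations over a finite set are taken entrywise.\<close>

definition mat_lincomb :: "nat \<Rightarrow> 'a set \<Rightarrow> ('a \<Rightarrow> real) \<Rightarrow> ('a \<Rightarrow> complex mat) \<Rightarrow> complex mat" where
  "mat_lincomb d \<Omega> c f = mat d d (\<lambda>(i, j). \<Sum>x\<in>\<Omega>. complex_of_real (c x) * f x $$ (i, j))"

definition mat_expect :: "nat \<Rightarrow> 'a set \<Rightarrow> 'a pmf \<Rightarrow> ('a \<Rightarrow> complex mat) \<Rightarrow> complex mat" where
  "mat_expect d \<Omega> \<mu> f = mat_lincomb d \<Omega> (pmf \<mu>) f"

definition mat_var :: "nat \<Rightarrow> 'a set \<Rightarrow> 'a pmf \<Rightarrow> ('a \<Rightarrow> complex mat) \<Rightarrow> complex mat" where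
  "mat_var d \<Omega> \<mu> f = mat_expect d \<Omega> \<mu> (\<lambda>x. f x ^\<^sub>m 2) - mat_expect d \<Omega> \<mu> f ^\<^sub>m 2"

definition generator_apply ::
  "nat \<Rightarrow> 'a set \<Rightarrow> ('a \<Rightarrow> 'a \<Rightarrow> real) \<Rightarrow> ('a \<Rightarrow> complex mat) \<Rightarrow> 'a \<Rightarrow> complex mat" where
  "generator_apply d \<Omega> Q f x = mat_lincomb d \<Omega> (Q x) f"

definition dirichlet_form ::
  "nat \<Rightarrow> 'a set \<Rightarrow> 'a pmf \<Rightarrow> ('a \<Rightarrow> 'a \<Rightarrow> real) \<Rightarrow> ('a \<Rightarrow> complex mat) \<Rightarrow> complex mat" where
  "dirichlet_form d \<Omega> \<mu> Q f = - mat_expect d \<Omega> \<mu> (\<lambda>x. f x * generator_apply d \<Omega> Q f x)"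

end

theory Submission
  imports Defs
begin

text \<open>Condition on one coordinate \<open>i\<close>. The law of total variance splits the variance of \<open>f\<close> into the
  variances under the two conditional laws and \<open>p (1 - p)\<close> times the squared difference of the
  conditional means. The stochastic covering property couples the two conditional laws; by
  homogeneity the coupled points differ at \<open>i\<close> and exactly one further coordinate, so by Jensen's
  inequality the squared difference is bounded by an energy along two-coordinate flips. Recursing
  on the conditional laws gives a generator for which the variance is at most the energy; averaging
  over the choice of \<open>i\<close> at each stage bounds its jump rates by \<open>2 k\<close>, and rescaling yields \<open>Q\<close>.\<close>

unbundle no vec_syntax
text \<open>Keeps the coordinate value \<open>1\<close> from turning into \<open>Suc 0\<close>, so
  that \<open>a(i := 1)\<close> has a single form throughout.\<close>

declare One_nat_def [simp del]

section \<open>Reduction to scalar functions\<close>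

text \<open>The matrix sum of the terms \<open>c x y\<close> times f(x) f(y), written entrywise.
  Variance and Dirichlet form both have this shape, so comparing them amounts to comparing two real
  kernels.\<close>

definition quad_mat ::
  "nat \<Rightarrow> 'a set \<Rightarrow> ('a \<Rightarrow> 'a \<Rightarrow> real) \<Rightarrow> ('a \<Rightarrow> complex mat) \<Rightarrow> complex mat" where
  "quad_mat d \<Omega> c f =
     mat d d (\<lambda>(i, j). \<Sum>x\<in>\<Omega>. \<Sum>y\<in>\<Omega>. complex_of_real (c x y) * (\<Sum>l<d. f x $$ (i, l) * f y $$ (l, j)))"

lemma hermitian_mats_iff:
  "A \<in> hermitian_mats d \<longleftrightarrow>
     A \<in> carrier_mat d d \<and> (\<forall>i<d. \<forall>j<d. A $$ (i, j) = cnj (A $$ (j, i)))"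
proof (cases "A \<in> carrier_mat d d")
  case True
  then have adj: "mat_adjoint A $$ (i, j) = cnj (A $$ (j, i))" if "i < d" "j < d" for i j
    using that by (simp add: mat_adjoint_def mat_of_rows_index)
  have "mat_adjoint A \<in> carrier_mat d d"
    using True by (auto simp: mat_adjoint_def)
  then have "mat_adjoint A = A \<longleftrightarrow> (\<forall>i<d. \<forall>j<d. mat_adjoint A $$ (i, j) = A $$ (i, j))"
    using True by (auto intro: eq_matI)
  also have "\<dots> \<longleftrightarrow> (\<forall>i<d. \<forall>j<d. A $$ (i, j) = cnj (A $$ (j, i)))"
    using adj by metis
  finally show ?thesis
    using True unfolding hermitian_mats_def by blast
qed (simp add: hermitian_mats_def)

text \<open>Taking adjoints turns f(x) f(y) into f(y) f(x), and the symmetry of \<open>c\<close>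
  absorbs this exchange of \<open>x\<close> and \<open>y\<close>.\<close>

lemma hermitian_mats_quad_mat:
  assumes f: "f \<in> \<Omega> \<rightarrow> hermitian_mats d"
    and sym: "\<And>x y. x \<in> \<Omega> \<Longrightarrow> y \<in> \<Omega> \<Longrightarrow> c x y = c y x"
  shows "quad_mat d \<Omega> c f \<in> hermitian_mats d"
proof -
  have h: "cnj (f x $$ (i, j)) = f x $$ (j, i)" if "x \<in> \<Omega>" "i < d" "j < d" for x i j
    using f that unfolding Pi_iff hermitian_mats_iff by metis
  have "quad_mat d \<Omega> c f $$ (i, j) = cnj (quad_mat d \<Omega> c f $$ (j, i))" if ij: "i < d" "j < d" for i j
  proof -
    have swap: "(\<Sum>l<d. f x $$ (i, l) * f y $$ (l, j)) = (\<Sum>l<d. cnj (f y $$ (j, l)) * cnj (f x $$ (l, i)))"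
      if "x \<in> \<Omega>" "y \<in> \<Omega>" for x y
      using that ij by (intro sum.cong refl) (simp add: h)
    have "quad_mat d \<Omega> c f $$ (i, j)
        = (\<Sum>y\<in>\<Omega>. \<Sum>x\<in>\<Omega>. complex_of_real (c x y) * (\<Sum>l<d. f x $$ (i, l) * f y $$ (l, j)))"
      using ij by (simp add: quad_mat_def) (rule sum.swap)
    also have "\<dots> = (\<Sum>y\<in>\<Omega>. \<Sum>x\<in>\<Omega>. complex_of_real (c y x) * (\<Sum>l<d. cnj (f y $$ (j, l)) * cnj (f x $$ (l, i))))"
    proof (intro sum.cong refl)
      fix y x assume "x \<in> \<Omega>" "y \<in> \<Omega>"
      show "complex_of_real (c x y) * (\<Sum>l<d. f x $$ (i, l) * f y $$ (l, j))
          = complex_of_real (c y x) * (\<Sum>l<d. cnj (f y $$ (j, l)) * cnj (f x $$ (l, i)))"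
        unfolding swap[OF \<open>x \<in> \<Omega>\<close> \<open>y \<in> \<Omega>\<close>] sym[OF \<open>x \<in> \<Omega>\<close> \<open>y \<in> \<Omega>\<close>] by (rule refl)
    qed
    also have "\<dots> = cnj (quad_mat d \<Omega> c f $$ (j, i))"
      using ij by (simp add: quad_mat_def)
    finally show ?thesis .
  qed
  then show ?thesis
    unfolding hermitian_mats_iff by (auto simp: quad_mat_def)
qed

text \<open>As every f(x) is Hermitian, the form at \<open>v\<close> is the sum over
  \<open>l\<close> of the \<open>c\<close>-forms of the complex functions sending \<open>x\<close>
  to the entry \<open>l\<close> of f(x) v. A real symmetric kernel acts separately on real and
  imaginary parts, so positivity on real functions suffices.\<close>

lemma pos_semidef_quad_mat:
  assumes f: "f \<in> \<Omega> \<rightarrow> hermitian_mats d"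
    and sym: "\<And>x y. x \<in> \<Omega> \<Longrightarrow> y \<in> \<Omega> \<Longrightarrow> c x y = c y x"
    and psd: "\<And>g :: 'a \<Rightarrow> real. 0 \<le> (\<Sum>x\<in>\<Omega>. \<Sum>y\<in>\<Omega>. c x y * (g x * g y))"
  shows "pos_semidef d (quad_mat d \<Omega> c f)"
  unfolding pos_semidef_def
proof (intro conjI ballI)
  show "quad_mat d \<Omega> c f \<in> hermitian_mats d"
    by (rule hermitian_mats_quad_mat[OF f sym])
  fix v :: "complex vec" assume v: "v \<in> carrier_vec d"
  have h: "cnj (f x $$ (i, j)) = f x $$ (j, i)" if "x \<in> \<Omega>" "i < d" "j < d" for x i j
    using f that unfolding Pi_iff hermitian_mats_iff by metis
  define u where "u l x = (\<Sum>j<d. f x $$ (l, j) * v $ j)" for l x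
  \<comment> \<open>Here Hermitian symmetry moves f(x) over to the left factor: the conjugate of
    f(x) v is the row vector v* f(x).\<close>
  have cnj_u: "cnj (u l x) = (\<Sum>i<d. cnj (v $ i) * f x $$ (i, l))" if "x \<in> \<Omega>" "l < d" for l x
    using that unfolding u_def by (auto simp: h mult.commute intro!: sum.cong)
  have "(quad_mat d \<Omega> c f *\<^sub>v v) \<bullet>c v
      = (\<Sum>i<d. (\<Sum>j<d. (\<Sum>x\<in>\<Omega>. \<Sum>y\<in>\<Omega>. complex_of_real (c x y) *
          (\<Sum>l<d. f x $$ (i, l) * f y $$ (l, j))) * v $ j) * cnj (v $ i))"
    using v by (simp add: quad_mat_def scalar_prod_def lessThan_atLeast0)
  also have "\<dots> = (\<Sum>i<d. \<Sum>j<d. \<Sum>x\<in>\<Omega>. \<Sum>y\<in>\<Omega>. \<Sum>l<d. complex_of_real (c x y) *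
          ((cnj (v $ i) * f x $$ (i, l)) * (f y $$ (l, j) * v $ j)))"
    by (simp add: sum_distrib_left sum_distrib_right mult_ac)
  also have "\<dots> = (\<Sum>i<d. \<Sum>x\<in>\<Omega>. \<Sum>y\<in>\<Omega>. \<Sum>l<d. \<Sum>j<d. complex_of_real (c x y) *
          ((cnj (v $ i) * f x $$ (i, l)) * (f y $$ (l, j) * v $ j)))"
    by (subst (2) sum.swap, rule sum.cong[OF refl], rule sum.cong[OF refl],
        subst sum.swap, rule sum.cong[OF refl], rule sum.swap)
  also have "\<dots> = (\<Sum>x\<in>\<Omega>. \<Sum>y\<in>\<Omega>. \<Sum>l<d. \<Sum>i<d. \<Sum>j<d. complex_of_real (c x y) *
          ((cnj (v $ i) * f x $$ (i, l)) * (f y $$ (l, j) * v $ j)))"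
    by (subst sum.swap, rule sum.cong[OF refl],
        subst sum.swap, rule sum.cong[OF refl], rule sum.swap)
  also have "\<dots> = (\<Sum>x\<in>\<Omega>. \<Sum>y\<in>\<Omega>. \<Sum>l<d. complex_of_real (c x y) * (cnj (u l x) * u l y))"
    by (intro sum.cong refl) (simp add: cnj_u, simp add: u_def sum_product, simp add: sum_distrib_left)
  also have "\<dots> = (\<Sum>l<d. \<Sum>x\<in>\<Omega>. \<Sum>y\<in>\<Omega>. complex_of_real (c x y) * (cnj (u l x) * u l y))"
    by (subst (2) sum.swap, subst sum.swap, rule refl)
  finally have eq: "Re ((quad_mat d \<Omega> c f *\<^sub>v v) \<bullet>c v)
      = (\<Sum>l<d. (\<Sum>x\<in>\<Omega>. \<Sum>y\<in>\<Omega>. c x y * (Re (u l x) * Re (u l y)))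
             + (\<Sum>x\<in>\<Omega>. \<Sum>y\<in>\<Omega>. c x y * (Im (u l x) * Im (u l y))))"
    by (simp add: sum.distrib algebra_simps)
  show "0 \<le> Re ((quad_mat d \<Omega> c f *\<^sub>v v) \<bullet>c v)"
    unfolding eq by (intro sum_nonneg add_nonneg_nonneg psd)
qed

text \<open>The diagonal part of the kernel produces the mean of the squares, the rank-one part the
  square of the mean.\<close>

lemma mat_var_eq_quad_mat:
  assumes "finite \<Omega>" and f: "f \<in> \<Omega> \<rightarrow> carrier_mat d d"
  shows "mat_var d \<Omega> \<mu> f
    = quad_mat d \<Omega> (\<lambda>x y. (if x = y then pmf \<mu> x else 0) - pmf \<mu> x * pmf \<mu> y) f"
proof (rule eq_matI)
  fix i j assume ij: "i < dim_row (quad_mat d \<Omega> (\<lambda>x y. (if x = y then pmf \<mu> x else 0) - pmf \<mu> x * pmf \<mu> y) f)"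
    "j < dim_col (quad_mat d \<Omega> (\<lambda>x y. (if x = y then pmf \<mu> x else 0) - pmf \<mu> x * pmf \<mu> y) f)"
  then have [simp]: "i < d" "j < d" by (simp_all add: quad_mat_def)
  have carr: "f x \<in> carrier_mat d d" if "x \<in> \<Omega>" for x using f that by auto
  have sq: "(f x ^\<^sub>m 2) $$ (i, j) = (\<Sum>l<d. f x $$ (i, l) * f x $$ (l, j))" if "x \<in> \<Omega>" for x
    using carr[OF that] by (simp add: numeral_2_eq_2 scalar_prod_def lessThan_atLeast0)
  have E: "(mat_expect d \<Omega> \<mu> f ^\<^sub>m 2) $$ (i, j)
      = (\<Sum>l<d. (\<Sum>x\<in>\<Omega>. complex_of_real (pmf \<mu> x) * f x $$ (i, l)) * (\<Sum>y\<in>\<Omega>. complex_of_real (pmf \<mu> y) * f y $$ (l, j)))"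
    by (simp add: numeral_2_eq_2 scalar_prod_def lessThan_atLeast0 mat_expect_def mat_lincomb_def)
  also have "\<dots> = (\<Sum>l<d. \<Sum>x\<in>\<Omega>. \<Sum>y\<in>\<Omega>. complex_of_real (pmf \<mu> x * pmf \<mu> y) * (f x $$ (i, l) * f y $$ (l, j)))"
    unfolding sum_product by (simp add: mult_ac)
  also have "\<dots> = (\<Sum>x\<in>\<Omega>. \<Sum>y\<in>\<Omega>. complex_of_real (pmf \<mu> x * pmf \<mu> y) * (\<Sum>l<d. f x $$ (i, l) * f y $$ (l, j)))"
    by (subst sum.swap, rule sum.cong[OF refl], subst sum.swap) (simp add: sum_distrib_left)
  finally have E2: "(mat_expect d \<Omega> \<mu> f ^\<^sub>m 2) $$ (i, j) = \<dots>" .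
  have "mat_expect d \<Omega> \<mu> (\<lambda>x. f x ^\<^sub>m 2) $$ (i, j)
      = (\<Sum>x\<in>\<Omega>. complex_of_real (pmf \<mu> x) * (\<Sum>l<d. f x $$ (i, l) * f x $$ (l, j)))"
    by (simp add: mat_expect_def mat_lincomb_def sq)
  also have "\<dots> = (\<Sum>x\<in>\<Omega>. \<Sum>y\<in>\<Omega>. if x = y then
      complex_of_real (pmf \<mu> x) * (\<Sum>l<d. f x $$ (i, l) * f y $$ (l, j)) else 0)"
    using assms(1) by (simp add: sum.delta)
  also have "\<dots> = (\<Sum>x\<in>\<Omega>. \<Sum>y\<in>\<Omega>. complex_of_real (if x = y then pmf \<mu> x else 0)
      * (\<Sum>l<d. f x $$ (i, l) * f y $$ (l, j)))"
    by (intro sum.cong refl) auto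
  finally have E1: "mat_expect d \<Omega> \<mu> (\<lambda>x. f x ^\<^sub>m 2) $$ (i, j) = \<dots>" .
  have "mat_var d \<Omega> \<mu> f $$ (i, j)
      = mat_expect d \<Omega> \<mu> (\<lambda>x. f x ^\<^sub>m 2) $$ (i, j) - (mat_expect d \<Omega> \<mu> f ^\<^sub>m 2) $$ (i, j)"
    unfolding mat_var_def by (subst index_minus_mat) (simp_all add: mat_expect_def mat_lincomb_def)
  then show "mat_var d \<Omega> \<mu> f $$ (i, j)
      = quad_mat d \<Omega> (\<lambda>x y. (if x = y then pmf \<mu> x else 0) - pmf \<mu> x * pmf \<mu> y) f $$ (i, j)"
    unfolding E1 E2 by (simp add: quad_mat_def sum_subtractf left_diff_distrib del: of_real_mult)
qed (simp_all add: mat_var_def quad_mat_def mat_expect_def mat_lincomb_def)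

lemma dirichlet_form_eq_quad_mat:
  assumes f: "f \<in> \<Omega> \<rightarrow> carrier_mat d d"
  shows "dirichlet_form d \<Omega> \<mu> Q f = quad_mat d \<Omega> (\<lambda>x y. - (pmf \<mu> x * Q x y)) f"
proof (rule eq_matI)
  fix i j assume ij: "i < dim_row (quad_mat d \<Omega> (\<lambda>x y. - (pmf \<mu> x * Q x y)) f)"
    "j < dim_col (quad_mat d \<Omega> (\<lambda>x y. - (pmf \<mu> x * Q x y)) f)"
  then have [simp]: "i < d" "j < d" by (simp_all add: quad_mat_def)
  have carr: "f x \<in> carrier_mat d d" if "x \<in> \<Omega>" for x using f that by auto
  have "(f x * generator_apply d \<Omega> Q f x) $$ (i, j)
      = (\<Sum>y\<in>\<Omega>. complex_of_real (Q x y) * (\<Sum>l<d. f x $$ (i, l) * f y $$ (l, j)))" if "x \<in> \<Omega>" for x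
  proof -
    have "(f x * generator_apply d \<Omega> Q f x) $$ (i, j)
        = (\<Sum>l<d. \<Sum>y\<in>\<Omega>. complex_of_real (Q x y) * (f x $$ (i, l) * f y $$ (l, j)))"
      using carr[OF that]
      by (simp add: scalar_prod_def lessThan_atLeast0 generator_apply_def mat_lincomb_def
          sum_distrib_left mult_ac)
    then show ?thesis by (subst (asm) sum.swap) (simp add: sum_distrib_left)
  qed
  then show "dirichlet_form d \<Omega> \<mu> Q f $$ (i, j)
      = quad_mat d \<Omega> (\<lambda>x y. - (pmf \<mu> x * Q x y)) f $$ (i, j)"
    by (simp add: dirichlet_form_def mat_expect_def mat_lincomb_def quad_mat_def
        sum_distrib_left sum_negf mult_ac)
qed (simp_all add: dirichlet_form_def quad_mat_def mat_expect_def mat_lincomb_def)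

text \<open>The matrix inequality reduces to the scalar one: for a vector \<open>v\<close>, the quadratic forms of both
  sides at \<open>v\<close> are sums of scalar quadratic forms over the real and imaginary parts of the entries
  of \<open>x \<mapsto> f x v\<close>.\<close>

lemma psd_le_mat_var_dirichlet_form:
  assumes fin: "finite \<Omega>" and f: "f \<in> \<Omega> \<rightarrow> hermitian_mats d"
    and rev: "reversible \<Omega> \<mu> Q"
    and scalar: "\<And>g :: 'a \<Rightarrow> real. (\<Sum>x\<in>\<Omega>. pmf \<mu> x * (g x)\<^sup>2) - (\<Sum>x\<in>\<Omega>. pmf \<mu> x * g x)\<^sup>2
       \<le> - C * (\<Sum>x\<in>\<Omega>. \<Sum>y\<in>\<Omega>. pmf \<mu> x * Q x y * (g x * g y))"
  shows "psd_le d (mat_var d \<Omega> \<mu> f) (complex_of_real C \<cdot>\<^sub>m dirichlet_form d \<Omega> \<mu> Q f)"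
proof -
  \<comment> \<open>\<open>a\<close> is the kernel of the variance and \<open>b\<close> that of
    \<open>C\<close> times the Dirichlet form; the assumption \<open>scalar\<close> says exactly
    that the form of \<open>b - a\<close> is nonnegative on real functions.\<close>
  define a where "a x y = (if x = y then pmf \<mu> x else 0) - pmf \<mu> x * pmf \<mu> y" for x y
  define b where "b x y = - C * (pmf \<mu> x * Q x y)" for x y
  have f': "f \<in> \<Omega> \<rightarrow> carrier_mat d d"
    using f by (auto simp: hermitian_mats_def)
  have var: "mat_var d \<Omega> \<mu> f = quad_mat d \<Omega> a f"
    unfolding a_def by (rule mat_var_eq_quad_mat[OF fin f'])
  have dir: "complex_of_real C \<cdot>\<^sub>m dirichlet_form d \<Omega> \<mu> Q f = quad_mat d \<Omega> b f"
    unfolding dirichlet_form_eq_quad_mat[OF f']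
    by (rule eq_matI) (simp_all add: quad_mat_def b_def sum_distrib_left sum_negf mult_ac)
  have diff: "quad_mat d \<Omega> b f - quad_mat d \<Omega> a f = quad_mat d \<Omega> (\<lambda>x y. b x y - a x y) f"
    by (rule eq_matI) (simp_all add: quad_mat_def sum_subtractf left_diff_distrib)
  have a: "a x y = a y x" for x y by (simp add: a_def)
  have b: "b x y = b y x" if "x \<in> \<Omega>" "y \<in> \<Omega>" for x y
    using rev that by (simp add: b_def reversible_def)
  have "0 \<le> (\<Sum>x\<in>\<Omega>. \<Sum>y\<in>\<Omega>. (b x y - a x y) * (g x * g y))" for g :: "'a \<Rightarrow> real"
  proof -
    have "(\<Sum>x\<in>\<Omega>. \<Sum>y\<in>\<Omega>. a x y * (g x * g y))
        = (\<Sum>x\<in>\<Omega>. \<Sum>y\<in>\<Omega>. (if x = y then pmf \<mu> x * (g x * g y) else 0))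
          - (\<Sum>x\<in>\<Omega>. \<Sum>y\<in>\<Omega>. (pmf \<mu> x * g x) * (pmf \<mu> y * g y))"
      unfolding sum_subtractf[symmetric] a_def by (intro sum.cong refl) (simp add: algebra_simps)
    also have "\<dots> = (\<Sum>x\<in>\<Omega>. pmf \<mu> x * (g x)\<^sup>2) - (\<Sum>x\<in>\<Omega>. pmf \<mu> x * g x)\<^sup>2"
      using fin by (simp add: power2_eq_square sum_product)
    finally have "(\<Sum>x\<in>\<Omega>. \<Sum>y\<in>\<Omega>. a x y * (g x * g y))
        \<le> (\<Sum>x\<in>\<Omega>. \<Sum>y\<in>\<Omega>. b x y * (g x * g y))"
      using scalar[of g] by (simp add: b_def sum_distrib_left sum_negf mult_ac)
    then show ?thesis
      by (simp add: left_diff_distrib sum_subtractf)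
  qed
  with a b have "pos_semidef d (quad_mat d \<Omega> (\<lambda>x y. b x y - a x y) f)"
    by (intro pos_semidef_quad_mat[OF f]) auto
  with hermitian_mats_quad_mat[OF f a] hermitian_mats_quad_mat[OF f b] show ?thesis
    unfolding psd_le_def var dir diff by simp
qed

section \<open>Variance and couplings\<close>

text \<open>For nonnegative \<open>w\<close> this is the mass of \<open>E\<close> times the variance
  under \<open>w\<close> conditioned on \<open>E\<close>. Left unnormalised, it needs no extra
  factors when blocks are joined, and division by zero gives the right value 0 on a block of mass
  zero.\<close>

definition local_var :: "('a \<Rightarrow> real) \<Rightarrow> 'a set \<Rightarrow> ('a \<Rightarrow> real) \<Rightarrow> real" where
  "local_var w E f = (\<Sum>x\<in>E. w x * (f x)\<^sup>2) - (\<Sum>x\<in>E. w x * f x)\<^sup>2 / sum w E"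

lemma local_var_singleton: "local_var w {x} f = 0"
  by (simp add: local_var_def power2_eq_square)

lemma local_var_null:
  assumes "finite E" "\<And>x. x \<in> E \<Longrightarrow> 0 \<le> w x" "sum w E = 0"
  shows "local_var w E f = 0"
proof -
  have "\<forall>x\<in>E. w x = 0" using assms by (simp add: sum_nonneg_eq_0_iff)
  then show ?thesis by (simp add: local_var_def)
qed

text \<open>Jensen's inequality for the square, from the nonnegativity of the second moment of
  \<open>h\<close> about its \<open>K\<close>-mean \<open>m\<close>.\<close>

lemma weighted_mean_square_le:
  fixes K h :: "'a \<Rightarrow> 'b \<Rightarrow> real"
  assumes "finite A" "finite B" and nonneg: "\<And>x y. 0 \<le> K x y" and one: "(\<Sum>x\<in>A. \<Sum>y\<in>B. K x y) = 1"
  shows "(\<Sum>x\<in>A. \<Sum>y\<in>B. K x y * h x y)\<^sup>2 \<le> (\<Sum>x\<in>A. \<Sum>y\<in>B. K x y * (h x y)\<^sup>2)"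
proof -
  define m where "m = (\<Sum>x\<in>A. \<Sum>y\<in>B. K x y * h x y)"
  have "0 \<le> (\<Sum>x\<in>A. \<Sum>y\<in>B. K x y * (h x y - m)\<^sup>2)"
    by (intro sum_nonneg mult_nonneg_nonneg nonneg) auto
  also have "\<dots> = (\<Sum>x\<in>A. \<Sum>y\<in>B. K x y * (h x y)\<^sup>2 - 2 * m * (K x y * h x y) + m\<^sup>2 * K x y)"
    by (intro sum.cong refl) (simp add: power2_diff algebra_simps)
  also have "\<dots> = (\<Sum>x\<in>A. \<Sum>y\<in>B. K x y * (h x y)\<^sup>2) - 2 * m * m + m\<^sup>2 * 1"
    unfolding one[symmetric] by (subst (3) m_def) (simp add: sum.distrib sum_subtractf sum_distrib_left)
  finally show ?thesis
    by (simp add: m_def[symmetric] power2_eq_square)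
qed

text \<open>By the law of total variance, the part between the blocks is a b / (a + b) times the
  squared difference of the conditional means \<open>p / a\<close> and \<open>q / b\<close>. The
  coupling \<open>K\<close> writes this difference as the \<open>K\<close>-mean of
  \<open>f x - f y\<close>, and Jensen's inequality bounds its square.\<close>

lemma local_var_Un_le:
  assumes fin: "finite A" "finite B" and disj: "A \<inter> B = {}"
    and pos: "0 < sum w A" "0 < sum w B"
    and K: "\<And>x y. 0 \<le> K x y"
    and marg_A: "\<And>x. x \<in> A \<Longrightarrow> (\<Sum>y\<in>B. K x y) = w x / sum w A"
    and marg_B: "\<And>y. y \<in> B \<Longrightarrow> (\<Sum>x\<in>A. K x y) = w y / sum w B"
  shows "local_var w (A \<union> B) f \<le> local_var w A f + local_var w B f
    + sum w A * sum w B / (sum w A + sum w B) * (\<Sum>x\<in>A. \<Sum>y\<in>B. K x y * (f x - f y)\<^sup>2)"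
proof -
  define a b p q where "a = sum w A" and "b = sum w B"
    and "p = (\<Sum>x\<in>A. w x * f x)" and "q = (\<Sum>x\<in>B. w x * f x)"
  have ab: "0 < a" "0 < b" using pos by (auto simp: a_def b_def)
  have "(\<Sum>x\<in>A. \<Sum>y\<in>B. K x y) = 1"
    using ab by (simp add: marg_A sum_divide_distrib[symmetric] a_def[symmetric])
  moreover have "(\<Sum>x\<in>A. \<Sum>y\<in>B. K x y * (f x - f y)) = p / a - q / b"
  proof -
    have "(\<Sum>x\<in>A. \<Sum>y\<in>B. K x y * (f x - f y))
        = (\<Sum>x\<in>A. f x * (\<Sum>y\<in>B. K x y)) - (\<Sum>x\<in>A. \<Sum>y\<in>B. f y * K x y)"
      by (simp add: right_diff_distrib sum_subtractf sum_distrib_left mult.commute)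
    also have "(\<Sum>x\<in>A. \<Sum>y\<in>B. f y * K x y) = (\<Sum>y\<in>B. f y * (\<Sum>x\<in>A. K x y))"
      by (subst sum.swap) (simp add: sum_distrib_left)
    also have "(\<Sum>x\<in>A. f x * (\<Sum>y\<in>B. K x y)) = p / a"
      by (simp add: marg_A p_def a_def sum_divide_distrib mult.commute)
    also have "(\<Sum>y\<in>B. f y * (\<Sum>x\<in>A. K x y)) = q / b"
      by (simp add: marg_B q_def b_def sum_divide_distrib mult.commute)
    finally show ?thesis .
  qed
  ultimately have "(p / a - q / b)\<^sup>2 \<le> (\<Sum>x\<in>A. \<Sum>y\<in>B. K x y * (f x - f y)\<^sup>2)"
    using weighted_mean_square_le[OF fin, where K = K and h = "\<lambda>x y. f x - f y"] K by simp
  then have "a * b / (a + b) * (p / a - q / b)\<^sup>2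
      \<le> a * b / (a + b) * (\<Sum>x\<in>A. \<Sum>y\<in>B. K x y * (f x - f y)\<^sup>2)"
    using ab by (intro mult_left_mono) auto
  moreover have "p\<^sup>2 / a + q\<^sup>2 / b - (p + q)\<^sup>2 / (a + b) = a * b / (a + b) * (p / a - q / b)\<^sup>2"
  proof -
    have "a + b \<noteq> 0" "a \<noteq> 0" "b \<noteq> 0" using ab by auto
    then show ?thesis by (simp add: divide_simps power2_eq_square) (simp add: algebra_simps)
  qed
  ultimately show ?thesis
    unfolding local_var_def sum.union_disjoint[OF fin disj]
      a_def[symmetric] b_def[symmetric] p_def[symmetric] q_def[symmetric] by linarith
qed

section \<open>Cylinder sets of the cube\<close>

definition cylinder :: "nat \<Rightarrow> nat set \<Rightarrow> (nat \<Rightarrow> nat) \<Rightarrow> (nat \<Rightarrow> nat) set" where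
  "cylinder n S a = {x \<in> hcube {1..n}. restrict x S = a}"

lemma finite_hcube [simp]: "finite T \<Longrightarrow> finite (hcube T)"
  unfolding hcube_def by (simp add: finite_PiE)

lemma cylinder_subset: "cylinder n S a \<subseteq> hcube {1..n}"
  by (auto simp: cylinder_def)

lemma finite_cylinder [simp]: "finite (cylinder n S a)"
  using cylinder_subset by (rule finite_subset) simp

lemma hcube_update: "a \<in> hcube S \<Longrightarrow> b \<in> {0, 1} \<Longrightarrow> a(i := b) \<in> hcube (insert i S)"
  unfolding hcube_def PiE_iff extensional_def by auto

lemma cylinder_insert:
  assumes "a \<in> hcube S" "i \<notin> S"
  shows "cylinder n (insert i S) (a(i := b)) = {x \<in> cylinder n S a. x i = b}"
proof -
  have "restrict x (insert i S) = a(i := b) \<longleftrightarrow> restrict x S = a \<and> x i = b" for x :: "nat \<Rightarrow> nat"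
  proof
    assume h: "restrict x (insert i S) = a(i := b)"
    have "restrict x S j = a j" for j
      using fun_cong[OF h, of j] assms by (cases "j = i") (auto simp: hcube_def split: if_splits)
    then show "restrict x S = a \<and> x i = b" using fun_cong[OF h, of i] by auto
  qed (use assms in \<open>auto simp: fun_eq_iff restrict_def\<close>)
  then show ?thesis by (auto simp: cylinder_def)
qed

lemma cylinder_split:
  assumes "a \<in> hcube S" "i \<notin> S" "i \<in> {1..n}"
  shows "cylinder n S a = cylinder n (insert i S) (a(i := 1)) \<union> cylinder n (insert i S) (a(i := 0))"
    and "cylinder n (insert i S) (a(i := 1)) \<inter> cylinder n (insert i S) (a(i := 0)) = {}"
proof -
  have "x i \<in> {0, 1}" if "x \<in> cylinder n S a" for x
    using that assms(3) by (auto simp: cylinder_def hcube_def PiE_iff extensional_restrict)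
  then show "cylinder n S a = cylinder n (insert i S) (a(i := 1)) \<union> cylinder n (insert i S) (a(i := 0))"
    unfolding cylinder_insert[OF assms(1,2)] by blast
qed (auto simp: cylinder_insert[OF assms(1,2)])

lemma cylinder_full:
  assumes "a \<in> hcube {1..n}"
  shows "cylinder n {1..n} a = {a}"
  using assms by (auto simp: cylinder_def hcube_def PiE_iff extensional_restrict)

text \<open>Handles the degenerate split, where one value of the revealed coordinate has probability
  zero and there is no conditional law to couple.\<close>

lemma local_var_Un_null:
  assumes "finite A" "finite B" "A \<inter> B = {}" "\<And>x. x \<in> A \<Longrightarrow> 0 \<le> w x" "sum w A = 0"
  shows "local_var w (A \<union> B) f = local_var w B f"
proof -
  have "\<forall>x\<in>A. w x = 0" using assms by (simp add: sum_nonneg_eq_0_iff)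
  then show ?thesis using assms(1-3) by (simp add: local_var_def sum.union_disjoint)
qed

section \<open>Energies of edge weights\<close>

definition energy :: "'a set \<Rightarrow> ('a \<Rightarrow> 'a \<Rightarrow> real) \<Rightarrow> ('a \<Rightarrow> real) \<Rightarrow> real" where
  "energy \<Omega> W f = (\<Sum>x\<in>\<Omega>. \<Sum>y\<in>\<Omega>. W x y * (f x - f y)\<^sup>2) / 2"

lemma energy_add: "energy \<Omega> (\<lambda>x y. U x y + V x y) f = energy \<Omega> U f + energy \<Omega> V f"
  by (simp add: energy_def distrib_right sum.distrib add_divide_distrib)

lemma energy_scale: "energy \<Omega> (\<lambda>x y. c * U x y) f = c * energy \<Omega> U f"
  by (simp add: energy_def sum_distrib_left mult.assoc)

lemma energy_sum: "energy \<Omega> (\<lambda>x y. \<Sum>i\<in>I. U i x y) f = (\<Sum>i\<in>I. energy \<Omega> (U i) f)"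
proof -
  have "(\<Sum>x\<in>\<Omega>. \<Sum>y\<in>\<Omega>. (\<Sum>i\<in>I. U i x y) * (f x - f y)\<^sup>2)
      = (\<Sum>i\<in>I. \<Sum>x\<in>\<Omega>. \<Sum>y\<in>\<Omega>. U i x y * (f x - f y)\<^sup>2)"
    unfolding sum_distrib_right by (subst sum.swap, subst (2) sum.swap) (rule refl)
  then show ?thesis by (simp add: energy_def sum_divide_distrib)
qed

lemma energy_swap: "energy \<Omega> (\<lambda>x y. U y x) f = energy \<Omega> U f"
  unfolding energy_def by (subst sum.swap) (simp add: power2_commute)

section \<open>Marginals of a joint law as finite sums\<close>

lemma sum_pmf_fst:
  assumes "finite B" "snd ` set_pmf \<kappa> \<subseteq> B"
  shows "(\<Sum>y\<in>B. pmf \<kappa> (x, y)) = pmf (map_pmf fst \<kappa>) x"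
proof -
  have "fst -` {x} \<inter> set_pmf \<kappa> = ({x} \<times> B) \<inter> set_pmf \<kappa>" using assms(2) by force
  then have "pmf (map_pmf fst \<kappa>) x = measure_pmf.prob \<kappa> ({x} \<times> B)"
    unfolding pmf_map by (metis measure_Int_set_pmf)
  also have "\<dots> = (\<Sum>z\<in>{x} \<times> B. pmf \<kappa> z)"
    by (rule measure_measure_pmf_finite) (simp add: assms(1))
  also have "\<dots> = (\<Sum>y\<in>B. pmf \<kappa> (x, y))"
    using sum.cartesian_product[of "\<lambda>x y. pmf \<kappa> (x, y)" B "{x}"] by simp
  finally show ?thesis ..
qed

lemma sum_pmf_snd:
  assumes "finite A" "fst ` set_pmf \<kappa> \<subseteq> A"
  shows "(\<Sum>x\<in>A. pmf \<kappa> (x, y)) = pmf (map_pmf snd \<kappa>) y"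
proof -
  let ?sw = "\<lambda>(x, y). (y, x)"
  have inj: "inj ?sw" by (auto intro: injI)
  have "(\<Sum>x\<in>A. pmf \<kappa> (x, y)) = (\<Sum>x\<in>A. pmf (map_pmf ?sw \<kappa>) (y, x))"
    by (rule sum.cong[OF refl]) (use pmf_map_inj'[OF inj, of \<kappa> "(x, y)" for x] in simp)
  also have "\<dots> = pmf (map_pmf fst (map_pmf ?sw \<kappa>)) y"
    by (rule sum_pmf_fst) (use assms in \<open>auto simp: image_image case_prod_beta\<close>)
  also have "map_pmf fst (map_pmf ?sw \<kappa>) = map_pmf snd \<kappa>"
    by (simp add: pmf.map_comp o_def case_prod_beta)
  finally show ?thesis .
qed

section \<open>Covering couplings of conditional laws\<close>

locale homogeneous_scp =
  fixes n k :: nat and \<mu> :: "(nat \<Rightarrow> nat) pmf"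
  assumes supp: "set_pmf \<mu> \<subseteq> hcube {1..n}"
    and homogeneous: "homogeneous n k \<mu>"
    and scp: "stochastic_covering n \<mu>"
begin

abbreviation "cube \<equiv> hcube {1..n}"

definition mass :: "nat set \<Rightarrow> (nat \<Rightarrow> nat) \<Rightarrow> real" where
  "mass S a = sum (pmf \<mu>) (cylinder n S a)"

lemma mass_nonneg: "0 \<le> mass S a"
  unfolding mass_def by (intro sum_nonneg) simp

lemma sum_coordinates: "\<xi> \<in> set_pmf \<mu> \<Longrightarrow> (\<Sum>i\<in>{1..n}. \<xi> i) = k"
  using homogeneous unfolding homogeneous_def
  by (subst (asm) measure_pmf.prob_eq_1) (auto simp: AE_measure_pmf_iff)

lemma prob_restr_event: "measure_pmf.prob \<mu> (restr_event S a) = mass S a"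
proof -
  have "restr_event S a \<inter> set_pmf \<mu> = cylinder n S a \<inter> set_pmf \<mu>"
    using supp by (auto simp: restr_event_def cylinder_def)
  then have "measure_pmf.prob \<mu> (restr_event S a) = measure_pmf.prob \<mu> (cylinder n S a)"
    by (metis measure_Int_set_pmf)
  then show ?thesis by (simp add: mass_def measure_measure_pmf_finite)
qed

lemma cond_pmf_cylinder:
  assumes "0 < mass S a"
  shows "set_pmf (cond_pmf \<mu> (restr_event S a)) = set_pmf \<mu> \<inter> cylinder n S a"
    and "x \<in> cylinder n S a \<Longrightarrow> pmf (cond_pmf \<mu> (restr_event S a)) x = pmf \<mu> x / mass S a"
proof -
  have ne: "set_pmf \<mu> \<inter> restr_event S a \<noteq> {}"
    using assms unfolding prob_restr_event[symmetric]
    by (simp add: measure_pmf_zero_iff[symmetric])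
  show "set_pmf (cond_pmf \<mu> (restr_event S a)) = set_pmf \<mu> \<inter> cylinder n S a"
    unfolding set_cond_pmf[OF ne] using supp by (auto simp: restr_event_def cylinder_def)
  show "pmf (cond_pmf \<mu> (restr_event S a)) x = pmf \<mu> x / mass S a" if "x \<in> cylinder n S a"
    using that unfolding pmf_cond[OF ne] prob_restr_event by (simp add: restr_event_def cylinder_def)
qed

text \<open>\<open>cond_law\<close> forgets the coordinates in \<open>S\<close>, but under the
  conditional law these are equal to \<open>a\<close>, so putting \<open>a\<close> back loses
  nothing. This lifts couplings over the free coordinates to couplings on the whole cube.\<close>

lemma map_merge_cond_law:
  assumes "0 < mass S a" "S \<subseteq> {1..n}"
  shows "map_pmf (\<lambda>u j. if j \<in> S then a j else u j) (cond_law n \<mu> S a) = cond_pmf \<mu> (restr_event S a)"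
proof -
  have "(\<lambda>j. if j \<in> S then a j else restrict \<xi> ({1..n} - S) j) = \<xi>"
    if "\<xi> \<in> set_pmf (cond_pmf \<mu> (restr_event S a))" for \<xi>
  proof
    fix j
    have \<xi>: "\<xi> \<in> cube" "restrict \<xi> S = a"
      using that unfolding cond_pmf_cylinder(1)[OF assms(1)] by (auto simp: cylinder_def)
    then have "a j = \<xi> j" if "j \<in> S" using that by (metis restrict_apply')
    moreover have "\<xi> j = undefined" if "j \<notin> {1..n}"
      using \<xi> that by (auto simp: hcube_def PiE_def extensional_def)
    ultimately show "(if j \<in> S then a j else restrict \<xi> ({1..n} - S) j) = \<xi> j" by simp
  qed
  then have "map_pmf (\<lambda>\<xi> j. if j \<in> S then a j else restrict \<xi> ({1..n} - S) j)
      (cond_pmf \<mu> (restr_event S a)) = map_pmf (\<lambda>\<xi>. \<xi>) (cond_pmf \<mu> (restr_event S a))"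
    by (intro map_pmf_cong refl)
  then show ?thesis unfolding cond_law_def pmf.map_comp o_def by simp
qed

text \<open>Homogeneity excludes the diagonal part of the covering coupling: the two points differ at
  \<open>i\<close>, so they must differ at exactly one further coordinate.\<close>

lemma covering_coupling:
  assumes S: "S \<subseteq> {1..n}" and a: "a \<in> hcube S" and i: "i \<in> {1..n} - S"
    and pos: "0 < mass (insert i S) (a(i := 1))" "0 < mass (insert i S) (a(i := 0))"
  obtains \<kappa> where
    "map_pmf fst \<kappa> = cond_pmf \<mu> (restr_event (insert i S) (a(i := 1)))"
    "map_pmf snd \<kappa> = cond_pmf \<mu> (restr_event (insert i S) (a(i := 0)))"
    "set_pmf \<kappa> \<subseteq> two_flip_pairs n"
proof -
  define S' T where "S' = insert i S" and "T = {1..n} - S'"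
  have S': "S' \<subseteq> {1..n}" and "i \<in> S'" using S i by (auto simp: S'_def)
  define m where "m b u = (\<lambda>j. if j \<in> S' then b j else u j)" for b u :: "nat \<Rightarrow> nat"
  \<comment> \<open>Raising coordinate \<open>i\<close> in the condition lowers the law of the rest.
    So the first marginal of the covering coupling is the law given 1, and its first point lies
    below the second by at most one coordinate.\<close>
  have "point_le S' (a(i := 0)) (a(i := 1))"
    unfolding point_le_def using hcube_update[OF a] \<open>i \<in> S'\<close> by (auto simp: S'_def)
  then have "measure_le T (cond_law n \<mu> S' (a(i := 1))) (cond_law n \<mu> S' (a(i := 0)))"
    using scp S' pos unfolding stochastic_covering_def prob_restr_event T_def
    by (auto simp: S'_def point_le_def)
  then obtain \<kappa> where \<kappa>: "map_pmf fst \<kappa> = cond_law n \<mu> S' (a(i := 1))"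
      "map_pmf snd \<kappa> = cond_law n \<mu> S' (a(i := 0))"
      "set_pmf \<kappa> \<subseteq> {(u, v). point_le T u v}"
    unfolding measure_le_def is_coupling_def by blast
  define \<kappa>' where "\<kappa>' = map_pmf (\<lambda>z. (m (a(i := 1)) (fst z), m (a(i := 0)) (snd z))) \<kappa>"
  have fst: "map_pmf fst \<kappa>' = cond_pmf \<mu> (restr_event S' (a(i := 1)))"
  proof -
    have "map_pmf fst \<kappa>' = map_pmf (m (a(i := 1))) (map_pmf fst \<kappa>)"
      unfolding \<kappa>'_def pmf.map_comp by (simp add: o_def)
    also have "\<dots> = cond_pmf \<mu> (restr_event S' (a(i := 1)))"
      unfolding \<kappa>(1) m_def by (rule map_merge_cond_law[of S' "a(i := 1)"]) (use S' pos in \<open>auto simp: S'_def\<close>)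
    finally show ?thesis .
  qed
  have snd: "map_pmf snd \<kappa>' = cond_pmf \<mu> (restr_event S' (a(i := 0)))"
  proof -
    have "map_pmf snd \<kappa>' = map_pmf (m (a(i := 0))) (map_pmf snd \<kappa>)"
      unfolding \<kappa>'_def pmf.map_comp by (simp add: o_def)
    also have "\<dots> = cond_pmf \<mu> (restr_event S' (a(i := 0)))"
      unfolding \<kappa>(2) m_def by (rule map_merge_cond_law[of S' "a(i := 0)"]) (use S' pos in \<open>auto simp: S'_def\<close>)
    finally show ?thesis .
  qed
  have "set_pmf \<kappa>' \<subseteq> two_flip_pairs n"
  proof
    fix z assume z: "z \<in> set_pmf \<kappa>'"
    then obtain u v where uv: "(u, v) \<in> set_pmf \<kappa>" and z': "z = (m (a(i := 1)) u, m (a(i := 0)) v)"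
      by (auto simp: \<kappa>'_def)
    obtain x y where xy: "z = (x, y)" by (cases z)
    have x: "x = m (a(i := 1)) u" and y: "y = m (a(i := 0)) v" using z' xy by auto
    have "x \<in> set_pmf (map_pmf fst \<kappa>')" "y \<in> set_pmf (map_pmf snd \<kappa>')"
      using z by (force simp: xy)+
    then have in_supp: "x \<in> set_pmf \<mu>" "y \<in> set_pmf \<mu>"
      unfolding fst snd using pos by (auto simp: cond_pmf_cylinder S'_def)
    have "(\<Sum>j\<in>{1..n}. x j) = (\<Sum>j\<in>{1..n}. y j)"
      using in_supp by (simp add: sum_coordinates)
    moreover have xi: "x i = 1" "y i = 0" using \<open>i \<in> S'\<close> by (auto simp: x y m_def)
    moreover have outside_T: "x j = y j" if "j \<in> {1..n} - T - {i}" for j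
      using that by (auto simp: x y m_def T_def)
    moreover have "i \<in> {1..n}" using i by simp
    \<comment> \<open>With equal coordinate sums, the excess of \<open>x\<close> over
      \<open>y\<close> at \<open>i\<close> must be compensated elsewhere; this refutes
      \<open>u = v\<close> in the first case below.\<close>
    ultimately have ne: "\<exists>j\<in>{1..n} - {i}. x j \<noteq> y j"
      by (metis (no_types, lifting) add_right_cancel finite_atLeastAtMost one_neq_zero sum.cong sum.remove)
    have on_T: "x j = u j" "y j = v j" if "j \<in> T" for j
      using that by (auto simp: x y m_def T_def)
    have "point_le T u v" using \<kappa>(3) uv by auto
    then consider "u = v" | l where "l \<in> T" "u l = 0" "v l = 1" "\<forall>j\<in>T - {l}. u j = v j"
      unfolding point_le_def by blast
    then have "card {j \<in> {1..n}. x j \<noteq> y j} = 2"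
    proof cases
      case 1
      then show ?thesis using ne outside_T on_T by (metis DiffD1 DiffD2 DiffI)
    next
      case 2
      have "j = i \<or> j = l" if "j \<in> {1..n}" "x j \<noteq> y j" for j
        using that outside_T[of j] on_T[of j] 2(4) by (cases "j \<in> T") auto
      moreover have "x l \<noteq> y l" using on_T[OF 2(1)] 2 by simp
      moreover have "l \<in> {1..n}" "l \<noteq> i" using 2(1) \<open>i \<in> S'\<close> by (auto simp: T_def)
      ultimately have "{j \<in> {1..n}. x j \<noteq> y j} = {i, l}" using xi \<open>i \<in> {1..n}\<close> by auto
      then show ?thesis using \<open>l \<noteq> i\<close> by simp
    qed
    then show "z \<in> two_flip_pairs n"
      using in_supp supp by (auto simp: xy two_flip_pairs_def)
  qed
  with fst snd show ?thesis by (intro that[of \<kappa>']) (auto simp: S'_def)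
qed

lemma mass_split:
  assumes "a \<in> hcube S" "i \<in> {1..n} - S"
  shows "mass S a = mass (insert i S) (a(i := 1)) + mass (insert i S) (a(i := 0))"
  unfolding mass_def using assms cylinder_split[of a S i n] by (simp add: sum.union_disjoint)

text \<open>The edge weights paying for one split at \<open>i\<close>: the covering coupling, scaled
  by the factor from \<open>local_var_Un_le\<close> and symmetrised. The row bound is a single
  formula for both values of \<open>x i\<close>, chosen so that it can be summed over
  \<open>i\<close> by homogeneity.\<close>

lemma cross_weights:
  assumes S: "S \<subseteq> {1..n}" and a: "a \<in> hcube S" and i: "i \<in> {1..n} - S"
  obtains C :: "(nat \<Rightarrow> nat) \<Rightarrow> (nat \<Rightarrow> nat) \<Rightarrow> real" where
    "\<And>x y. 0 \<le> C x y" "\<And>x y. C x y = C y x"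
    "\<And>x y. C x y \<noteq> 0 \<Longrightarrow> x \<in> cylinder n S a \<and> (x, y) \<in> two_flip_pairs n"
    "\<And>x. x \<in> cylinder n S a \<Longrightarrow> (\<Sum>y\<in>cube. C x y)
       \<le> (real (x i) + mass (insert i S) (a(i := 1)) / mass S a) * pmf \<mu> x"
    "\<And>f. local_var (pmf \<mu>) (cylinder n S a) f
       \<le> local_var (pmf \<mu>) (cylinder n (insert i S) (a(i := 1))) f
         + local_var (pmf \<mu>) (cylinder n (insert i S) (a(i := 0))) f + energy cube C f"
proof -
  define A B where "A = cylinder n (insert i S) (a(i := 1))" and "B = cylinder n (insert i S) (a(i := 0))"
  define p q where "p = mass (insert i S) (a(i := 1))" and "q = mass (insert i S) (a(i := 0))"
  have pA: "p = sum (pmf \<mu>) A" and qB: "q = sum (pmf \<mu>) B"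
    by (simp_all add: p_def q_def A_def B_def mass_def)
  have p0: "0 \<le> p" and q0: "0 \<le> q" by (simp_all add: p_def q_def mass_nonneg)
  have split: "cylinder n S a = A \<union> B" "A \<inter> B = {}"
    using cylinder_split a i unfolding A_def B_def by auto
  have fin: "finite A" "finite B" by (simp_all add: A_def B_def)
  have m: "mass S a = p + q" using mass_split[OF a i] by (simp add: p_def q_def)
  have A: "x i = 1" if "x \<in> A" for x
    using that i cylinder_insert[OF a, of i n 1] by (auto simp: A_def)
  have B: "x i = 0" if "x \<in> B" for x
    using that i cylinder_insert[OF a, of i n 0] by (auto simp: B_def)
  show ?thesis
  proof (cases "p = 0 \<or> q = 0")
    case True
    have "local_var (pmf \<mu>) (A \<union> B) f = local_var (pmf \<mu>) A f + local_var (pmf \<mu>) B f" for f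
    proof (cases "p = 0")
      case True
      then show ?thesis
        using fin split(2) local_var_Un_null[of A B "pmf \<mu>" f] local_var_null[of A "pmf \<mu>" f] by (simp add: pA)
    next
      case False
      then have "q = 0" using \<open>p = 0 \<or> q = 0\<close> by simp
      then show ?thesis
        using fin split(2) local_var_Un_null[of B A "pmf \<mu>" f] local_var_null[of B "pmf \<mu>" f]
        by (simp add: qB Un_commute Int_commute)
    qed
    \<comment> \<open>If one half has mass zero, there is no variance between the halves and zero
      weights suffice.\<close>
    then show ?thesis
      by (intro that[of "\<lambda>_ _. 0"])
         (use mass_nonneg in \<open>auto simp: energy_def split(1) A_def[symmetric] B_def[symmetric] simp del: One_nat_def\<close>)
  next
    case False
    then have pos: "0 < p" "0 < q" using p0 q0 by auto
    obtain \<kappa> where \<kappa>: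
      "map_pmf fst \<kappa> = cond_pmf \<mu> (restr_event (insert i S) (a(i := 1)))"
      "map_pmf snd \<kappa> = cond_pmf \<mu> (restr_event (insert i S) (a(i := 0)))"
      "set_pmf \<kappa> \<subseteq> two_flip_pairs n"
      using covering_coupling[OF S a i] pos unfolding p_def q_def by metis
    have A_supp: "fst ` set_pmf \<kappa> \<subseteq> A"
      unfolding set_map_pmf[symmetric] \<kappa>(1) A_def using pos by (simp add: cond_pmf_cylinder p_def)
    have B_supp: "snd ` set_pmf \<kappa> \<subseteq> B"
      unfolding set_map_pmf[symmetric] \<kappa>(2) B_def using pos by (simp add: cond_pmf_cylinder q_def)
    define K where "K x y = pmf \<kappa> (x, y)" for x y
    have K_supp: "x \<in> A \<and> y \<in> B \<and> (x, y) \<in> two_flip_pairs n" if "K x y \<noteq> 0" for x y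
    proof -
      have "(x, y) \<in> set_pmf \<kappa>" using that by (simp add: K_def set_pmf_iff)
      then show ?thesis using A_supp B_supp \<kappa>(3) by force
    qed
    have K_out: "K x y = 0" if "x \<notin> A \<or> y \<notin> B" for x y
      using K_supp that by blast
    have marg_A: "(\<Sum>y\<in>B. K x y) = pmf \<mu> x / p" if "x \<in> A" for x
      using sum_pmf_fst[OF fin(2) B_supp] cond_pmf_cylinder(2)[of "insert i S" "a(i := 1)" x] pos that
      unfolding K_def \<kappa>(1) A_def p_def by simp
    have marg_B: "(\<Sum>x\<in>A. K x y) = pmf \<mu> y / q" if "y \<in> B" for y
      using sum_pmf_snd[OF fin(1) A_supp] cond_pmf_cylinder(2)[of "insert i S" "a(i := 0)" y] pos that
      unfolding K_def \<kappa>(2) B_def q_def by simp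
    have sub: "A \<subseteq> cube" "B \<subseteq> cube" unfolding A_def B_def by (rule cylinder_subset)+
    have row: "(\<Sum>y\<in>cube. K x y) = (\<Sum>y\<in>B. K x y)" for x
      by (rule sum.mono_neutral_right) (use sub in \<open>auto simp: K_out\<close>)
    have col: "(\<Sum>x\<in>cube. K x y) = (\<Sum>x\<in>A. K x y)" for y
      by (rule sum.mono_neutral_right) (use sub in \<open>auto simp: K_out\<close>)
    define c where "c = p * q / (p + q)"
    have c: "0 \<le> c" using pos by (simp add: c_def)
    \<comment> \<open>\<open>K\<close> lives on \<open>A\<close> times \<open>B\<close>, so in every
      row of \<open>C\<close> only one of the two summands contributes.\<close>
    define C where "C x y = c * (K x y + K y x)" for x y
    have K0: "0 \<le> K x y" for x y by (simp add: K_def)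
    have flip_sym: "(x, y) \<in> two_flip_pairs n" if "(y, x) \<in> two_flip_pairs n" for x y
    proof -
      have "{j \<in> {1..n}. x j \<noteq> y j} = {j \<in> {1..n}. y j \<noteq> x j}" by auto
      then show ?thesis using that by (simp add: two_flip_pairs_def)
    qed
    show ?thesis
    proof (rule that[of C])
      show "0 \<le> C x y" for x y using c K0 by (simp add: C_def)
      show "C x y = C y x" for x y by (simp add: C_def)
      show "x \<in> cylinder n S a \<and> (x, y) \<in> two_flip_pairs n" if "C x y \<noteq> 0" for x y
      proof -
        have "K x y \<noteq> 0 \<or> K y x \<noteq> 0" using that by (auto simp: C_def)
        then show ?thesis using K_supp[of x y] K_supp[of y x] flip_sym split(1) by auto
      qed
      fix x assume "x \<in> cylinder n S a"
      then consider "x \<in> A" | "x \<in> B" using split by auto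
      then show "(\<Sum>y\<in>cube. C x y)
          \<le> (real (x i) + mass (insert i S) (a(i := 1)) / mass S a) * pmf \<mu> x"
      proof cases
        case 1
        have "K y x = 0" for y using K_supp[of y x] 1 split(2) by auto
        then have "(\<Sum>y\<in>cube. C x y) = c * (pmf \<mu> x / p)"
          using marg_A[OF 1] by (simp add: C_def sum_distrib_left[symmetric] row)
        also have "\<dots> = q / (p + q) * pmf \<mu> x"
          using pos by (simp add: c_def)
        \<comment> \<open>A crude bound suffices here: q / (p + q) is at most 1, which is the value
          of \<open>x i\<close> on \<open>A\<close>.\<close>
        also have "\<dots> \<le> 1 * pmf \<mu> x"
          using pos by (intro mult_right_mono) auto
        also have "\<dots> \<le> (1 + p / (p + q)) * pmf \<mu> x"
          using pos by (intro mult_right_mono) auto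
        finally show ?thesis using A[OF 1] by (simp add: m p_def)
      next
        case 2
        have "K x y = 0" for y using K_supp[of x y] 2 split(2) by auto
        then have "(\<Sum>y\<in>cube. C x y) = c * (pmf \<mu> x / q)"
          using marg_B[OF 2] by (simp add: C_def sum_distrib_left[symmetric] col)
        also have "\<dots> = p / (p + q) * pmf \<mu> x"
          using pos by (simp add: c_def)
        finally show ?thesis using B[OF 2] by (simp add: m p_def)
      qed
    next
      fix f
      \<comment> \<open>\<open>K\<close> and its transpose have equal energy, which cancels the
        division by 2 in \<open>energy\<close>.\<close>
      have "energy cube C f = c * (energy cube K f + energy cube (\<lambda>x y. K y x) f)"
        unfolding C_def energy_scale energy_add ..
      also have "\<dots> = c * (\<Sum>x\<in>cube. \<Sum>y\<in>cube. K x y * (f x - f y)\<^sup>2)"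
        unfolding energy_swap[of cube K f] by (simp add: energy_def)
      also have "(\<Sum>x\<in>cube. \<Sum>y\<in>cube. K x y * (f x - f y)\<^sup>2)
          = (\<Sum>x\<in>A. \<Sum>y\<in>cube. K x y * (f x - f y)\<^sup>2)"
        by (rule sum.mono_neutral_right) (use sub in \<open>auto simp: K_out\<close>)
      also have "\<dots> = (\<Sum>x\<in>A. \<Sum>y\<in>B. K x y * (f x - f y)\<^sup>2)"
        by (rule sum.cong[OF refl], rule sum.mono_neutral_right) (use sub in \<open>auto simp: K_out\<close>)
      finally show "local_var (pmf \<mu>) (cylinder n S a) f
        \<le> local_var (pmf \<mu>) (cylinder n (insert i S) (a(i := 1))) f
         + local_var (pmf \<mu>) (cylinder n (insert i S) (a(i := 0))) f + energy cube C f"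
        using local_var_Un_le[OF fin split(2), of "pmf \<mu>" K f] pos K0 marg_A marg_B
        unfolding split(1) A_def[symmetric] B_def[symmetric] pA[symmetric] qB[symmetric] c_def by simp
    qed
  qed
qed

section \<open>Averaging over the first revealed coordinate\<close>

text \<open>\<open>W x y\<close> stands for \<open>pmf \<mu> x\<close> times a jump rate from
  \<open>x\<close> to \<open>y\<close>, so \<open>R x\<close> bounds the total jump rate at
  \<open>x\<close>. Leaving the factor \<open>pmf \<mu> x\<close> undivided makes sense of the bound
  at null points, where it forces the row of \<open>W\<close> to vanish on the cube.\<close>

definition poincare_weights ::
  "nat set \<Rightarrow> (nat \<Rightarrow> nat) \<Rightarrow> ((nat \<Rightarrow> nat) \<Rightarrow> real) \<Rightarrow> ((nat \<Rightarrow> nat) \<Rightarrow> (nat \<Rightarrow> nat) \<Rightarrow> real) \<Rightarrow> bool" where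
  "poincare_weights S a R W \<longleftrightarrow>
     (\<forall>x y. 0 \<le> W x y \<and> W x y = W y x) \<and>
     (\<forall>x y. W x y \<noteq> 0 \<longrightarrow> x \<in> cylinder n S a \<and> (x, y) \<in> two_flip_pairs n) \<and>
     (\<forall>x\<in>cylinder n S a. (\<Sum>y\<in>cube. W x y) \<le> R x * pmf \<mu> x) \<and>
     (\<forall>f. local_var (pmf \<mu>) (cylinder n S a) f \<le> energy cube W f)"

text \<open>Every condition is preserved by convex combinations of the pairs
  \<open>(R i, W i)\<close>; for the variance bound this uses that \<open>energy\<close> is linear
  in the weights.\<close>

lemma poincare_weights_average:
  assumes "finite I" "I \<noteq> {}" and W: "\<And>i. i \<in> I \<Longrightarrow> poincare_weights S a (R i) (W i)"
  shows "poincare_weights S a (\<lambda>x. (\<Sum>i\<in>I. R i x) / card I) (\<lambda>x y. (1 / card I) * (\<Sum>i\<in>I. W i x y))"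
  unfolding poincare_weights_def
proof (intro conjI allI ballI impI)
  fix x y
  show "0 \<le> 1 / real (card I) * (\<Sum>i\<in>I. W i x y)"
    using W by (auto simp: poincare_weights_def intro!: divide_nonneg_nonneg sum_nonneg)
  show "1 / real (card I) * (\<Sum>i\<in>I. W i x y) = 1 / real (card I) * (\<Sum>i\<in>I. W i y x)"
    by (intro arg_cong2[where f = "(*)"] sum.cong refl) (use W in \<open>auto simp: poincare_weights_def\<close>)
  assume "1 / real (card I) * (\<Sum>i\<in>I. W i x y) \<noteq> 0"
  then obtain i where "i \<in> I" "W i x y \<noteq> 0"
    by (metis mult_zero_right sum.neutral)
  then show "x \<in> cylinder n S a" "(x, y) \<in> two_flip_pairs n"
    using W unfolding poincare_weights_def by blast+
next
  fix x assume x: "x \<in> cylinder n S a"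
  have row: "(\<Sum>y\<in>cube. W i x y) \<le> R i x * pmf \<mu> x" if "i \<in> I" for i
    using W[OF that] x unfolding poincare_weights_def by blast
  have "(\<Sum>y\<in>cube. 1 / real (card I) * (\<Sum>i\<in>I. W i x y))
      = 1 / real (card I) * (\<Sum>i\<in>I. \<Sum>y\<in>cube. W i x y)"
    by (subst sum.swap) (simp add: sum_distrib_left)
  also have "\<dots> \<le> 1 / real (card I) * (\<Sum>i\<in>I. R i x * pmf \<mu> x)"
    using row by (intro mult_left_mono sum_mono) auto
  finally show "(\<Sum>y\<in>cube. 1 / real (card I) * (\<Sum>i\<in>I. W i x y)) \<le> (\<Sum>i\<in>I. R i x) / card I * pmf \<mu> x"
    by (simp add: sum_distrib_right)
next
  fix f
  have "card I * local_var (pmf \<mu>) (cylinder n S a) f = (\<Sum>i\<in>I. local_var (pmf \<mu>) (cylinder n S a) f)"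
    by simp
  also have "\<dots> \<le> (\<Sum>i\<in>I. energy cube (W i) f)"
    using W by (intro sum_mono) (auto simp: poincare_weights_def)
  finally show "local_var (pmf \<mu>) (cylinder n S a) f
      \<le> energy cube (\<lambda>x y. (1 / card I) * (\<Sum>i\<in>I. W i x y)) f"
    unfolding energy_scale energy_sum using assms(1,2) by (simp add: field_simps card_gt_0_iff)
qed

text \<open>Rate bounds are compared after multiplication by \<open>pmf \<mu> x\<close>, so only
  points of the support matter; the identity \<open>sum_mass_coordinates\<close> is available only
  there.\<close>

lemma poincare_weights_mono:
  assumes "poincare_weights S a R W" "\<And>x. x \<in> cylinder n S a \<Longrightarrow> R x * pmf \<mu> x \<le> R' x * pmf \<mu> x"
  shows "poincare_weights S a R' W"
  using assms unfolding poincare_weights_def by (meson order_trans)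

text \<open>The weights \<open>W1\<close> and \<open>W0\<close> live on disjoint cylinders, so at
  each \<open>x\<close> only one of them uses up \<open>R x\<close>. Adding the cross weights of the
  split costs the second summand of the rate.\<close>

lemma poincare_weights_coordinate:
  assumes S: "S \<subseteq> {1..n}" and a: "a \<in> hcube S" and i: "i \<in> {1..n} - S"
    and W1: "poincare_weights (insert i S) (a(i := 1)) R W1"
    and W0: "poincare_weights (insert i S) (a(i := 0)) R W0"
  shows "\<exists>W. poincare_weights S a
    (\<lambda>x. R x + (real (x i) + mass (insert i S) (a(i := 1)) / mass S a)) W"
proof -
  obtain C where C: "\<And>x y. 0 \<le> C x y" "\<And>x y. C x y = C y x"
    "\<And>x y. C x y \<noteq> 0 \<Longrightarrow> x \<in> cylinder n S a \<and> (x, y) \<in> two_flip_pairs n"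
    "\<And>x. x \<in> cylinder n S a \<Longrightarrow> (\<Sum>y\<in>cube. C x y)
       \<le> (real (x i) + mass (insert i S) (a(i := 1)) / mass S a) * pmf \<mu> x"
    "\<And>f. local_var (pmf \<mu>) (cylinder n S a) f
       \<le> local_var (pmf \<mu>) (cylinder n (insert i S) (a(i := 1))) f
         + local_var (pmf \<mu>) (cylinder n (insert i S) (a(i := 0))) f + energy cube C f"
    using cross_weights[OF S a i] by metis
  let ?A = "cylinder n (insert i S) (a(i := 1))" and ?B = "cylinder n (insert i S) (a(i := 0))"
  have AB: "cylinder n S a = ?A \<union> ?B" "?A \<inter> ?B = {}"
    using cylinder_split a i by auto
  note W = W1[unfolded poincare_weights_def] W0[unfolded poincare_weights_def]
  have "(\<Sum>y\<in>cube. W1 x y + W0 x y + C x y)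
      \<le> (R x + (real (x i) + mass (insert i S) (a(i := 1)) / mass S a)) * pmf \<mu> x"
    if x: "x \<in> cylinder n S a" for x
  proof -
    have "(\<Sum>y\<in>cube. W1 x y) + (\<Sum>y\<in>cube. W0 x y) \<le> R x * pmf \<mu> x"
    proof (cases "x \<in> ?A")
      case True
      then have "W0 x y = 0" for y using W AB(2) by blast
      moreover have "(\<Sum>y\<in>cube. W1 x y) \<le> R x * pmf \<mu> x" using W True by blast
      ultimately show ?thesis by simp
    next
      case False
      then have "W1 x y = 0" for y using W by blast
      moreover have "x \<in> ?B" using False x AB(1) by blast
      then have "(\<Sum>y\<in>cube. W0 x y) \<le> R x * pmf \<mu> x" using W by blast
      ultimately show ?thesis by simp
    qed
    then show ?thesis using C(4)[OF x] by (simp add: sum.distrib distrib_right)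
  qed
  moreover have "local_var (pmf \<mu>) (cylinder n S a) f \<le> energy cube (\<lambda>x y. W1 x y + W0 x y + C x y) f" for f
  proof -
    have "local_var (pmf \<mu>) ?A f \<le> energy cube W1 f" "local_var (pmf \<mu>) ?B f \<le> energy cube W0 f"
      using W by blast+
    then show ?thesis using C(5)[of f] by (simp add: energy_add)
  qed
  moreover have "x \<in> cylinder n S a \<and> (x, y) \<in> two_flip_pairs n" if "W1 x y + W0 x y + C x y \<noteq> 0" for x y
  proof -
    have "W1 x y \<noteq> 0 \<or> W0 x y \<noteq> 0 \<or> C x y \<noteq> 0" using that by auto
    then show ?thesis using W C(3) AB(1) by blast
  qed
  moreover have "0 \<le> W1 x y + W0 x y + C x y" "W1 x y + W0 x y + C x y = W1 y x + W0 y x + C y x" for x y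
    using W C(1,2) by (simp_all add: add_nonneg_nonneg)
  ultimately show ?thesis
    unfolding poincare_weights_def by (intro exI[of _ "\<lambda>x y. W1 x y + W0 x y + C x y"]) blast
qed

text \<open>The left side is the conditional expectation of the number of ones among the free
  coordinates. By homogeneity this number is \<open>k\<close> minus the ones fixed by
  \<open>a\<close>, hence constant on the support within the cylinder and equal to its value at
  \<open>x\<close>.\<close>

lemma sum_mass_coordinates:
  assumes S: "S \<subseteq> {1..n}" and a: "a \<in> hcube S" and x: "x \<in> cylinder n S a" "pmf \<mu> x \<noteq> 0"
  shows "(\<Sum>i\<in>{1..n} - S. mass (insert i S) (a(i := 1)) / mass S a) = (\<Sum>i\<in>{1..n} - S. real (x i))"
proof -
  define r where "r = (\<Sum>i\<in>{1..n} - S. real (x i))"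
  have free: "(\<Sum>i\<in>{1..n} - S. real (y i)) = real k - (\<Sum>i\<in>S. real (a i))"
    if "y \<in> cylinder n S a" "pmf \<mu> y \<noteq> 0" for y
  proof -
    have "(\<Sum>i\<in>{1..n}. real (y i)) = real k"
      using sum_coordinates[of y] that(2) by (simp add: set_pmf_iff flip: of_nat_sum)
    moreover have "(\<Sum>i\<in>S. real (y i)) = (\<Sum>i\<in>S. real (a i))"
      using that(1) by (intro sum.cong refl) (auto simp: cylinder_def)
    ultimately show ?thesis using S by (simp add: sum_diff)
  qed
  have "mass (insert i S) (a(i := 1)) = (\<Sum>y\<in>cylinder n S a. pmf \<mu> y * real (y i))"
    if i: "i \<in> {1..n} - S" for i
  proof -
    have "y i \<in> {0, 1}" if "y \<in> cylinder n S a" for y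
      using that i by (auto simp: cylinder_def hcube_def PiE_iff)
    then have "(\<Sum>y\<in>cylinder n S a. pmf \<mu> y * real (y i))
        = (\<Sum>y\<in>cylinder n S a. if y i = 1 then pmf \<mu> y else 0)"
      by (intro sum.cong refl) force
    also have "\<dots> = (\<Sum>y\<in>{y \<in> cylinder n S a. y i = 1}. pmf \<mu> y)"
      by (rule sum.inter_filter[symmetric]) simp
    finally show ?thesis using i cylinder_insert[OF a, of i n 1] by (simp add: mass_def)
  qed
  then have "(\<Sum>i\<in>{1..n} - S. mass (insert i S) (a(i := 1)))
      = (\<Sum>y\<in>cylinder n S a. pmf \<mu> y * (\<Sum>i\<in>{1..n} - S. real (y i)))"
    by (simp add: sum_distrib_left) (rule sum.swap)
  also have "\<dots> = (\<Sum>y\<in>cylinder n S a. pmf \<mu> y * r)"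
    unfolding r_def by (intro sum.cong refl) (use free x in \<open>metis mult_zero_left\<close>)
  also have "\<dots> = mass S a * r"
    by (simp add: mass_def sum_distrib_right)
  finally have "(\<Sum>i\<in>{1..n} - S. mass (insert i S) (a(i := 1))) = mass S a * r" .
  moreover have "mass S a \<noteq> 0"
    using x unfolding mass_def by (subst sum_nonneg_eq_0_iff) auto
  ultimately show ?thesis by (simp add: sum_divide_distrib[symmetric] r_def)
qed

text \<open>Averaging over the coordinate revealed first keeps the jump rate bounded. If \<open>N\<close> coordinates are
  free and \<open>x\<close> has \<open>r\<close> ones among them, then the couplings contribute at most \<open>2 r / N\<close> (both \<open>x i\<close>
  and the conditional probability of \<open>\<xi> i = 1\<close> sum to \<open>r\<close> over the free \<open>i\<close>) and the recursively
  built weights at most \<open>2 r (N - 1) / N\<close>.\<close>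

lemma exists_poincare_weights:
  assumes "S \<subseteq> {1..n}" "a \<in> hcube S"
  shows "\<exists>W. poincare_weights S a (\<lambda>x. 2 * (\<Sum>i\<in>{1..n} - S. real (x i))) W"
  using assms
proof (induction "card ({1..n} - S)" arbitrary: S a)
  case 0
  \<comment> \<open>With no free coordinate left the cylinder is a single point, whose variance is
    zero.\<close>
  then have "S = {1..n}" by auto
  with 0 show ?case
    by (intro exI[of _ "\<lambda>_ _. 0"])
       (simp add: poincare_weights_def cylinder_full local_var_singleton energy_def del: One_nat_def)
next
  case (Suc N)
  define D where "D = {1..n} - S"
  have D: "card D = Suc N" "finite D" using Suc(2) by (simp_all add: D_def)
  then have ne: "D \<noteq> {}" by auto
  \<comment> \<open>The rate when \<open>i\<close> is revealed first: the inductive bound over the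
    remaining free coordinates plus the cost of the split at \<open>i\<close>.\<close>
  define R where "R i x = 2 * (\<Sum>j\<in>D - {i}. real (x j))
      + (real (x i) + mass (insert i S) (a(i := 1)) / mass S a)" for i x
  have "\<exists>W. poincare_weights S a (R i) W" if i: "i \<in> D" for i
  proof -
    have "{1..n} - insert i S = D - {i}" by (auto simp: D_def)
    moreover have "N = card ({1..n} - insert i S)" using D i calculation by simp
    moreover have "insert i S \<subseteq> {1..n}" using Suc i by (auto simp: D_def)
    ultimately have "\<exists>W. poincare_weights (insert i S) (a(i := b)) (\<lambda>x. 2 * (\<Sum>j\<in>D - {i}. real (x j))) W"
      if "b \<in> {0, 1}" for b
      using Suc(1)[of "insert i S" "a(i := b)"] hcube_update[OF Suc(4) that] by simp
    then obtain W1 W0 where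
      "poincare_weights (insert i S) (a(i := 1)) (\<lambda>x. 2 * (\<Sum>j\<in>D - {i}. real (x j))) W1"
      "poincare_weights (insert i S) (a(i := 0)) (\<lambda>x. 2 * (\<Sum>j\<in>D - {i}. real (x j))) W0"
      by blast
    then show ?thesis
      using poincare_weights_coordinate[OF Suc(3,4)] i unfolding R_def D_def by blast
  qed
  then obtain W where "\<And>i. i \<in> D \<Longrightarrow> poincare_weights S a (R i) (W i)" by metis
  from poincare_weights_average[OF D(2) ne this]
  have "poincare_weights S a (\<lambda>x. (\<Sum>i\<in>D. R i x) / card D) (\<lambda>x y. (1 / card D) * (\<Sum>i\<in>D. W i x y))" .
  then have "poincare_weights S a (\<lambda>x. 2 * (\<Sum>i\<in>D. real (x i))) (\<lambda>x y. (1 / card D) * (\<Sum>i\<in>D. W i x y))"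
  proof (rule poincare_weights_mono)
    fix x assume x: "x \<in> cylinder n S a"
    show "(\<Sum>i\<in>D. R i x) / card D * pmf \<mu> x \<le> 2 * (\<Sum>i\<in>D. real (x i)) * pmf \<mu> x"
    proof (cases "pmf \<mu> x = 0")
      case False
      define r where "r = (\<Sum>i\<in>D. real (x i))"
      \<comment> \<open>The inductive parts sum to 2 r (card D - 1). The two further
        \<open>r\<close> are the sums of \<open>x i\<close> and of the conditional
        probabilities.\<close>
      have "(\<Sum>i\<in>D. R i x) = (\<Sum>i\<in>D. 2 * (r - real (x i))) + r + r"
        unfolding R_def sum.distrib
        using sum_mass_coordinates[OF Suc(3,4) x False] D(2)
        by (simp add: sum_diff1 r_def D_def[symmetric])
      also have "\<dots> = 2 * (r * card D)"
        unfolding sum_distrib_left[symmetric] sum_subtractf r_def[symmetric] by (simp add: algebra_simps)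
      finally have sum_R: "(\<Sum>i\<in>D. R i x) = 2 * (r * card D)" .
      have "real (card D) \<noteq> 0" using D(1) by linarith
      then have "(\<Sum>i\<in>D. R i x) / card D = 2 * r" unfolding sum_R by simp
      then show ?thesis unfolding r_def by simp
    qed simp
  qed
  then show ?case by (auto simp: D_def)
qed

end

section \<open>The generator\<close>

text \<open>With nothing revealed, the rate bound is twice the number of ones, that is 2 k on the
  support. Dividing the weights by 2 k brings the rates down to 1, and the factor reappears in the
  variance inequality.\<close>

lemma (in homogeneous_scp) exists_generator:
  assumes k: "0 < k"
  shows "\<exists>Q :: (nat \<Rightarrow> nat) \<Rightarrow> (nat \<Rightarrow> nat) \<Rightarrow> real.
      markov_generator cube Q \<and>
      reversible cube \<mu> Q \<and>
      (\<forall>x\<in>cube. \<forall>y\<in>cube. x \<noteq> y \<and> (x, y) \<notin> two_flip_pairs n \<longrightarrow> Q x y = 0) \<and>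
      Max {- Q x x | x. x \<in> cube} \<le> 1 \<and>
      (\<forall>d. \<forall>f \<in> cube \<rightarrow> hermitian_mats d.
         psd_le d (mat_var d cube \<mu> f) (complex_of_real (2 * real k) \<cdot>\<^sub>m dirichlet_form d cube \<mu> Q f))"
proof -
  \<comment> \<open>The constant function \<open>undefined\<close> is the only point of the cube
    over the empty set, and its cylinder is the whole cube.\<close>
  have cyl: "cylinder n {} (\<lambda>_. undefined) = cube"
    by (auto simp: cylinder_def restrict_def)
  have "(\<lambda>_. undefined) \<in> hcube {}" by (simp add: hcube_def)
  then obtain W where W: "poincare_weights {} (\<lambda>_. undefined) (\<lambda>x. 2 * (\<Sum>i\<in>{1..n}. real (x i))) W"
    using exists_poincare_weights[of "{}"] by auto
  have W0: "0 \<le> W x y" and W_sym: "W x y = W y x" for x y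
    using W unfolding poincare_weights_def by blast+
  have W_supp: "W x y = 0" if "(x, y) \<notin> two_flip_pairs n" for x y
    using W that unfolding poincare_weights_def by blast
  have W_row: "(\<Sum>y\<in>cube. W x y) \<le> 2 * real k * pmf \<mu> x" if x: "x \<in> cube" for x
  proof -
    have "(\<Sum>y\<in>cube. W x y) \<le> 2 * (\<Sum>i\<in>{1..n}. real (x i)) * pmf \<mu> x"
      using W x unfolding poincare_weights_def cyl by blast
    also have "\<dots> = 2 * real k * pmf \<mu> x"
      using sum_coordinates[of x] by (cases "pmf \<mu> x = 0") (auto simp: set_pmf_iff simp flip: of_nat_sum)
    finally show ?thesis .
  qed
  have W_var: "local_var (pmf \<mu>) cube f \<le> energy cube W f" for f
    using W unfolding poincare_weights_def cyl by blast
  \<comment> \<open>The rates \<open>q\<close> below divide by \<open>pmf \<mu> x\<close> and are 0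
    at null points by convention; this agrees with the weights only because those vanish there
    too.\<close>
  have W_null: "W x y = 0" if "x \<in> cube" "y \<in> cube" "pmf \<mu> x = 0" for x y
  proof -
    have "W x y \<le> (\<Sum>y\<in>cube. W x y)"
      using that W0 by (intro member_le_sum) auto
    also have "\<dots> \<le> 0" using W_row[OF that(1)] that(3) by simp
    finally show ?thesis using W0[of x y] by simp
  qed
  have W_diag: "W x x = 0" for x
    by (rule W_supp) (simp add: two_flip_pairs_def)
  define q where "q x y = W x y / (2 * real k * pmf \<mu> x)" for x y
  \<comment> \<open>\<open>q\<close> has zero diagonal by \<open>W_diag\<close>, so subtracting its
    row sums on the diagonal makes the rows of \<open>Q\<close> sum to zero.\<close>
  define Q where "Q x y = q x y - (if x = y then \<Sum>z\<in>cube. q x z else 0)" for x y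
  have \<mu>q: "pmf \<mu> x * q x y = W x y / (2 * real k)" if "x \<in> cube" "y \<in> cube" for x y
    using W_null[OF that] k by (cases "pmf \<mu> x = 0") (auto simp: q_def)
  have Q_diag: "- Q x x = (\<Sum>z\<in>cube. q x z)" for x
    by (simp add: Q_def q_def W_diag)
  have "(\<Sum>z\<in>cube. q x z) = (\<Sum>z\<in>cube - {x}. Q x z)" if "x \<in> cube" for x
    using that by (subst sum.remove[of _ x]) (auto simp: Q_def q_def W_diag split: if_splits intro!: sum.cong)
  then have gen: "markov_generator cube Q"
    unfolding markov_generator_def using Q_diag W0
    by (auto simp: minus_equation_iff[of "Q _ _"] Q_def q_def intro!: divide_nonneg_nonneg)
  have "pmf \<mu> x * Q x y = pmf \<mu> y * Q y x" if "x \<in> cube" "y \<in> cube" for x y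
    using \<mu>q[OF that] \<mu>q[OF that(2,1)] W_sym[of x y] by (simp add: Q_def right_diff_distrib)
  then have rev: "reversible cube \<mu> Q" by (simp add: reversible_def)
  have off: "Q x y = 0" if "x \<noteq> y" "(x, y) \<notin> two_flip_pairs n" for x y
    using that by (simp add: Q_def q_def W_supp)
  have rate: "- Q x x \<le> 1" if "x \<in> cube" for x
    using W_row[OF that] k unfolding Q_diag q_def sum_divide_distrib[symmetric]
    by (cases "pmf \<mu> x = 0") (auto simp: divide_le_eq)
  have scalar: "(\<Sum>x\<in>cube. pmf \<mu> x * (g x)\<^sup>2) - (\<Sum>x\<in>cube. pmf \<mu> x * g x)\<^sup>2
       \<le> - (2 * real k) * (\<Sum>x\<in>cube. \<Sum>y\<in>cube. pmf \<mu> x * Q x y * (g x * g y))"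
    for g :: "(nat \<Rightarrow> nat) \<Rightarrow> real"
  proof -
    have row: "2 * real k * (\<Sum>y\<in>cube. pmf \<mu> x * Q x y * (g x * g y))
        = (\<Sum>y\<in>cube. W x y * (g x * g y)) - (\<Sum>y\<in>cube. W x y * (g x)\<^sup>2)" if x: "x \<in> cube" for x
    proof -
      have "(\<Sum>y\<in>cube. pmf \<mu> x * Q x y * (g x * g y))
          = (\<Sum>y\<in>cube. pmf \<mu> x * q x y * (g x * g y)
              - (if x = y then (\<Sum>z\<in>cube. pmf \<mu> x * q x z) * (g x * g y) else 0))"
        by (intro sum.cong refl) (simp add: Q_def sum_distrib_left algebra_simps)
      also have "\<dots> = (\<Sum>y\<in>cube. pmf \<mu> x * q x y * (g x * g y))
          - (\<Sum>z\<in>cube. pmf \<mu> x * q x z) * (g x * g x)"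
        using x by (simp add: sum_subtractf)
      also have "\<dots> = (\<Sum>y\<in>cube. W x y / (2 * real k) * (g x * g y))
          - (\<Sum>z\<in>cube. W x z / (2 * real k)) * (g x * g x)"
        using x \<mu>q by simp
      finally show ?thesis
        using k by (simp add: right_diff_distrib sum_distrib_left sum_distrib_right power2_eq_square)
    qed
    \<comment> \<open>Expanding the square, the two pure terms agree by symmetry of
      \<open>W\<close>; together with the mixed term they give the quadratic form of
      \<open>Q\<close> computed in \<open>row\<close>.\<close>
    have "energy cube W g
        = (\<Sum>x\<in>cube. \<Sum>y\<in>cube. W x y * (g x)\<^sup>2 + W x y * (g y)\<^sup>2 - 2 * (W x y * (g x * g y))) / 2"
      by (simp add: energy_def power2_diff algebra_simps)
    also have "\<dots> = ((\<Sum>x\<in>cube. \<Sum>y\<in>cube. W x y * (g x)\<^sup>2) + (\<Sum>x\<in>cube. \<Sum>y\<in>cube. W x y * (g y)\<^sup>2)) / 2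
        - (\<Sum>x\<in>cube. \<Sum>y\<in>cube. W x y * (g x * g y))"
      unfolding sum.distrib sum_subtractf sum_distrib_left[symmetric] by (simp add: field_simps)
    also have "(\<Sum>x\<in>cube. \<Sum>y\<in>cube. W x y * (g y)\<^sup>2) = (\<Sum>x\<in>cube. \<Sum>y\<in>cube. W x y * (g x)\<^sup>2)"
      by (subst sum.swap, intro sum.cong refl) (simp add: W_sym)
    finally have "energy cube W g = - (\<Sum>x\<in>cube. 2 * real k * (\<Sum>y\<in>cube. pmf \<mu> x * Q x y * (g x * g y)))"
      by (simp add: row sum_subtractf)
    then have "energy cube W g = - (2 * real k) * (\<Sum>x\<in>cube. \<Sum>y\<in>cube. pmf \<mu> x * Q x y * (g x * g y))"
      unfolding sum_distrib_left[symmetric] by simp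
    \<comment> \<open>With total mass 1, \<open>local_var\<close> on the whole cube is the ordinary
      variance.\<close>
    moreover have "sum (pmf \<mu>) cube = 1"
      using supp by (intro sum_pmf_eq_1) simp_all
    ultimately show ?thesis
      using W_var[of g] by (simp add: local_var_def)
  qed
  have "cube \<noteq> {}" using supp set_pmf_not_empty[of \<mu>] by auto
  then have "Max {- Q x x | x. x \<in> cube} \<le> 1"
    using rate unfolding Setcompr_eq_image by (subst Max_le_iff) auto
  moreover have "psd_le d (mat_var d cube \<mu> f) (complex_of_real (2 * real k) \<cdot>\<^sub>m dirichlet_form d cube \<mu> Q f)"
    if "f \<in> cube \<rightarrow> hermitian_mats d" for d f
    by (rule psd_le_mat_var_dirichlet_form[OF _ that rev scalar]) simp
  ultimately show ?thesis
    using gen rev off by (intro exI[of _ Q]) simp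
qed

theorem theorem1p4:
  fixes n k :: nat
    and \<mu> :: "(nat \<Rightarrow> nat) pmf"
    and \<Omega> :: "(nat \<Rightarrow> nat) set"
  assumes "k \<in> {1..n}"
    and "\<Omega> = hcube {1..n}"
    and "set_pmf \<mu> \<subseteq> \<Omega>"
    and "homogeneous n k \<mu>"
    and "stochastic_covering n \<mu>"
  shows "\<exists>Q :: (nat \<Rightarrow> nat) \<Rightarrow> (nat \<Rightarrow> nat) \<Rightarrow> real.
      markov_generator \<Omega> Q \<and>
      reversible \<Omega> \<mu> Q \<and>
      (\<forall>x\<in>\<Omega>. \<forall>y\<in>\<Omega>. x \<noteq> y \<and> (x, y) \<notin> two_flip_pairs n \<longrightarrow> Q x y = 0) \<and>
      Max {- Q x x | x. x \<in> \<Omega>} \<le> 1 \<and>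
      (\<forall>d. \<forall>f \<in> \<Omega> \<rightarrow> hermitian_mats d.
         psd_le d (mat_var d \<Omega> \<mu> f) (complex_of_real (2 * real k) \<cdot>\<^sub>m dirichlet_form d \<Omega> \<mu> Q f))"
proof -
  interpret homogeneous_scp n k \<mu>
    using assms by unfold_locales auto
  show ?thesis
    unfolding assms(2) by (rule exists_generator) (use assms(1) in simp)
qed

end
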